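(* Let $T>0$ and $g\in\widehat H^0(\mathbb R^2)$. Then: (i) $\mathcal R_T(0)=\bigcup_{L>0}\mathcal R_T^L(0)\subset\mathcal H$; (ii) $\mathcal R_T^L(0)\subset\mathcal R_T^{L'}(0)$ for $0<L<L'$; (iii) $f\in\mathcal R_T^1(0)\Leftrightarrow Lf\in\mathcal R_T^L(0)$, for $L>0$; (iv) $f\in\mathcal R_T^L(g)\Leftrightarrow\left(f-\frac1{4\pi T}e^{-\frac{|\cdot|^2}{4T}}*g\right)\in\mathcal R_T^L(0)$, for $L>0$; (v) $f\in\mathcal R_T(g)\Leftrightarrow\left(f-\frac1{4\pi T}e^{-\frac{|\cdot|^2}{4T}}*g\right)\in\mathcal R_T(0)$.
   Context: $\mathbb R_+=(0,+\infty)$; function spaces are complex. $\widehat H^0(\mathbb R^2)$ is the subspace of $L^2(\mathbb R^2)$ of functions even with respect to $x_1$. $\mathcal H=\{f\in L^2(\mathbb R^2): \exists h\in L^2(\mathbb R_+),\ f(x)=h(|x|^2)\text{ a.e. on }\mathbb R^2\}$. For $W^0\in\widehat H^0(\mathbb R^2)$ and $u\in L^\infty(0,T)$ put $$\mathcal W_0(\cdot,T)=\frac1{4\pi T}e^{-\frac{|\cdot|^2}{4T}}*W^0,\qquad \mathcal W_u(x,T)=-\frac1\pi\int_0^T\frac1{2\xi}e^{-\frac{|x|^2}{4\xi}}u(T-\xi)\,d\xi .$$ Then $W(\cdot,T)=\mathcal W_0(\cdot,T)+\mathcal W_u(\cdot,T)$ is the state at time $T$ of the unique solution of the control system $W_t=\Delta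 W-2\delta u(t)$, $W(\cdot,0)=W^0$ on $\mathbb R^2$. Let $$\mathcal R_T(W^0)=\{W^T\in\widehat H^0(\mathbb R^2):\exists u\in L^\infty(0,T),\ W^T=\mathcal W_0(\cdot,T)+\mathcal W_u(\cdot,T)\},$$ and let $\mathcal R_T^L(W^0)$ ($L>0$) be defined in the same way but with $u$ additionally required to satisfy $\|u\|_{L^\infty(0,T)}\le L$. *)

theory Defs
  imports "HOL-Probability.Essential_Supremum"
begin

text \<open>
  Elements of Lebesgue spaces are represented by functions rather than by classes of almost
  everywhere equal functions. Measurability is always with respect to the completed Lebesgue
  sigma-algebra, so that each set of functions below contains, with a function, every function
  that is equal to it almost everywhere; equality in a Lebesgue space is almost everywhere equality.
\<close>

definition L2_space :: "'a measure \<Rightarrow> ('a \<Rightarrow> complex) set" where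
  "L2_space M = {f \<in> borel_measurable M. integrable M (\<lambda>x. (norm (f x))\<^sup>2)}"

definition Linf_norm :: "'a measure \<Rightarrow> ('a \<Rightarrow> complex) \<Rightarrow> ereal" where
  "Linf_norm M u = esssup M (\<lambda>x. ereal (norm (u x)))"

definition Linf_space :: "'a measure \<Rightarrow> ('a \<Rightarrow> complex) set" where
  "Linf_space M = {u \<in> borel_measurable M. Linf_norm M u < \<infinity>}"

definition Hhat0 :: "(real^2 \<Rightarrow> complex) set" where
  "Hhat0 = {f \<in> L2_space lebesgue. AE x in lebesgue. f (vector [- (x$1), x$2]) = f x}"

definition H_radial :: "(real^2 \<Rightarrow> complex) set" where
  "H_radial = {f \<in> L2_space lebesgue.
     \<exists>h \<in> L2_space (lebesgue_on {0<..}). AE x in lebesgue. f x = h ((norm x)\<^sup>2)}"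

definition convol :: "('a::euclidean_space \<Rightarrow> complex) \<Rightarrow> ('a \<Rightarrow> complex) \<Rightarrow> 'a \<Rightarrow> complex" where
  "convol k f x = (LINT y|lebesgue. k (x - y) * f y)"

definition heat_kernel :: "real \<Rightarrow> real^2 \<Rightarrow> complex" where
  "heat_kernel T x = complex_of_real (1 / (4 * pi * T) * exp (- ((norm x)\<^sup>2) / (4 * T)))"

definition W_free :: "(real^2 \<Rightarrow> complex) \<Rightarrow> real \<Rightarrow> real^2 \<Rightarrow> complex" where
  "W_free W0 T = convol (heat_kernel T) W0"

text \<open>
  At \<open>x = 0\<close> the following integral may diverge, and its value is then \<open>0\<close> by convention;
  this concerns a null set only. Only the values of \<open>u\<close> on \<open>{0<..<T}\<close> are used.
\<close>

definition W_ctrl :: "(real \<Rightarrow> complex) \<Rightarrow> real \<Rightarrow> real^2 \<Rightarrow> complex" where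
  "W_ctrl u T x = - complex_of_real (1 / pi) *
     (LINT \<xi>|lebesgue_on {0<..<T}.
        complex_of_real (1 / (2 * \<xi>) * exp (- ((norm x)\<^sup>2) / (4 * \<xi>))) * u (T - \<xi>))"

definition Reach :: "real \<Rightarrow> (real^2 \<Rightarrow> complex) \<Rightarrow> (real^2 \<Rightarrow> complex) set" where
  "Reach T W0 = {WT \<in> Hhat0. \<exists>u \<in> Linf_space (lebesgue_on {0<..<T}).
     AE x in lebesgue. WT x = W_free W0 T x + W_ctrl u T x}"

definition Reach_bdd :: "real \<Rightarrow> real \<Rightarrow> (real^2 \<Rightarrow> complex) \<Rightarrow> (real^2 \<Rightarrow> complex) set" where
  "Reach_bdd T L W0 = {WT \<in> Hhat0. \<exists>u \<in> Linf_space (lebesgue_on {0<..<T}).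
     Linf_norm (lebesgue_on {0<..<T}) u \<le> ereal L \<and>
     (AE x in lebesgue. WT x = W_free W0 T x + W_ctrl u T x)}"

end

theory Submission
  imports Defs "HOL-Probability.Distributions"
begin

text \<open>The sets of reachable states scale and translate with the state equation because it is
  linear; the one thing to verify is that the free evolution preserves \<open>Hhat0\<close>. The inclusion
  in \<open>H_radial\<close> rests on the fact that a bounded control produces a state of modulus
  at most \<open>C min(|x|\<^sup>-\<^sup>2\<^sup>a, |x|\<^sup>-\<^sup>2)\<close>, for every \<open>0 < a < 1\<close>.\<close>

section \<open>Lebesgue measure: sigma-finiteness and measure-preserving reflections\<close>

text \<open>Completion does not change the measure of Borel sets, so a countable cover for
  \<open>lborel\<close> still works. This gives access to Tonelli's theorem and to measurability of
  parameter integrals over the completed measure.\<close>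

lemma sigma_finite_lebesgue: "sigma_finite_measure (lebesgue :: 'a::euclidean_space measure)"
proof
  obtain A :: "'a set set" where "countable A" "A \<subseteq> sets lborel" "\<Union>A = space lborel"
    "\<forall>a\<in>A. emeasure lborel a \<noteq> \<infinity>"
    using lborel.sigma_finite_countable by blast
  then show "\<exists>A::'a set set. countable A \<and> A \<subseteq> sets lebesgue \<and> \<Union>A = space lebesgue \<and>
      (\<forall>a\<in>A. emeasure lebesgue a \<noteq> \<infinity>)"
    by (intro exI[of _ A]) (auto simp: subset_iff)
qed

text \<open>The Jacobian factor in the affine change of variables is the product of the
  \<open>\<bar>c j\<bar>\<close>, which is 1.\<close>

lemma distr_lebesgue_reflection:
  fixes c :: "'a::euclidean_space \<Rightarrow> real" and t
  defines "R x \<equiv> t + (\<Sum>j\<in>Basis. (c j * (x \<bullet> j)) *\<^sub>R j)"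
  assumes c: "\<And>j. j \<in> Basis \<Longrightarrow> \<bar>c j\<bar> = 1"
  shows "distr lebesgue lebesgue R = lebesgue" "R \<in> lebesgue \<rightarrow>\<^sub>M lebesgue"
proof -
  have c0: "\<And>j. j \<in> Basis \<Longrightarrow> c j \<noteq> 0"
    using c by fastforce
  show "R \<in> lebesgue \<rightarrow>\<^sub>M lebesgue"
    unfolding R_def by (rule lebesgue_affine_measurable[OF c0])
  have "lebesgue = density (distr lebesgue lebesgue R) (\<lambda>_. \<Prod>j\<in>Basis. \<bar>c j\<bar>)"
    unfolding R_def by (rule lebesgue_affine_euclidean[OF c0])
  also have "(\<Prod>j\<in>Basis. \<bar>c j\<bar>) = 1"
    by (simp add: c)
  finally show "distr lebesgue lebesgue R = lebesgue"
    by (simp add: density_1)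
qed

text \<open>The case of all signs negative. It serves the substitution in a convolution and the time
  reversal \<open>T - \<xi>\<close> of a control.\<close>

lemma distr_lebesgue_minus:
  fixes t :: "'a::euclidean_space"
  shows "distr lebesgue lebesgue ((-) t) = lebesgue" "(-) t \<in> lebesgue \<rightarrow>\<^sub>M lebesgue"
proof -
  have "(-) t = (\<lambda>x. t + (\<Sum>j\<in>Basis. (- 1 * (x \<bullet> j)) *\<^sub>R j))"
    by (simp add: fun_eq_iff sum_negf euclidean_representation)
  then show "distr lebesgue lebesgue ((-) t) = lebesgue" "(-) t \<in> lebesgue \<rightarrow>\<^sub>M lebesgue"
    using distr_lebesgue_reflection[of "\<lambda>_. - 1" t] by simp_all
qed

section \<open>Square integrability, convolution and the Gaussian kernel\<close>

lemma L2_space_diff: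
  assumes "f \<in> L2_space M" "g \<in> L2_space M"
  shows "(\<lambda>x. f x - g x) \<in> L2_space M"
proof -
  have [measurable]: "f \<in> borel_measurable M" "g \<in> borel_measurable M"
    using assms by (auto simp: L2_space_def)
  have "integrable M (\<lambda>x. 2 * (norm (f x))\<^sup>2 + 2 * (norm (g x))\<^sup>2)"
    using assms by (auto simp: L2_space_def)
  moreover have bound: "norm ((norm (f x - g x))\<^sup>2) \<le> norm (2 * (norm (f x))\<^sup>2 + 2 * (norm (g x))\<^sup>2)" for x
  proof -
    have "(norm (f x - g x))\<^sup>2 \<le> (norm (f x) + norm (g x))\<^sup>2"
      by (intro power_mono norm_triangle_ineq4) simp
    also have "\<dots> \<le> 2 * (norm (f x))\<^sup>2 + 2 * (norm (g x))\<^sup>2"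
      using sum_squares_bound[of "norm (f x)" "norm (g x)"] by (simp add: power2_sum)
    finally show ?thesis by simp
  qed
  moreover have "(\<lambda>x. (norm (f x - g x))\<^sup>2) \<in> borel_measurable M"
    by measurable
  ultimately have "integrable M (\<lambda>x. (norm (f x - g x))\<^sup>2)"
    using bound by (blast intro: Bochner_Integration.integrable_bound always_eventually)
  then show ?thesis
    by (simp add: L2_space_def)
qed

lemma L2_space_cmult:
  assumes "f \<in> L2_space M"
  shows "(\<lambda>x. c * f x) \<in> L2_space M"
proof -
  have "f \<in> borel_measurable M" and int: "integrable M (\<lambda>x. (norm (f x))\<^sup>2)"
    using assms by (auto simp: L2_space_def)
  then have "(\<lambda>x. c * f x) \<in> borel_measurable M"
    by measurable
  moreover have "integrable M (\<lambda>x. (norm (c * f x))\<^sup>2)"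
    unfolding norm_mult power_mult_distrib using int by (rule integrable_mult_right)
  ultimately show ?thesis
    by (simp add: L2_space_def)
qed

text \<open>By Cauchy--Schwarz with respect to the measure \<open>\<bar>k(x - y)\<bar> dy\<close>,
  \<open>\<bar>k * f\<bar>\<^sup>2 \<le> \<parallel>k\<parallel>\<^sub>1 (\<bar>k\<bar> * \<bar>f\<bar>\<^sup>2)\<close>, and Tonelli's theorem finishes the estimate.\<close>

lemma convol_in_L2_space:
  fixes k :: "'a::euclidean_space \<Rightarrow> complex"
  assumes k: "integrable lborel k" and f: "f \<in> L2_space lebesgue"
  shows "convol k f \<in> L2_space lebesgue"
proof -
  interpret L: sigma_finite_measure "lebesgue :: 'a measure"
    by (rule sigma_finite_lebesgue)
  \<comment> \<open>The two factors differ on purpose: the convolution is Borel measurable in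
    \<open>x\<close>, which can run over \<open>lborel\<close>, while \<open>f\<close> is only
    Lebesgue measurable, so \<open>y\<close> runs over \<open>lebesgue\<close>.\<close>
  interpret P: pair_sigma_finite "lborel :: 'a measure" "lebesgue :: 'a measure" ..
  have [measurable]: "k \<in> borel_measurable borel"
    using borel_measurable_integrable[OF k] by simp
  have [measurable]: "f \<in> borel_measurable lebesgue"
    using f by (simp add: L2_space_def)
  \<comment> \<open>Subtraction is Borel measurable; inserting \<open>id\<close> passes
    \<open>y\<close> from the completed sigma-algebra to the Borel one.\<close>
  have [measurable]: "id \<in> lebesgue \<rightarrow>\<^sub>M (borel :: 'a measure)"
    by (simp add: id_def measurable_completion)
  have diff [measurable]: "(\<lambda>(x, y). x - y) \<in> borel \<Otimes>\<^sub>M lebesgue \<rightarrow>\<^sub>M (borel :: 'a measure)"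
  proof -
    have "(\<lambda>p. fst p - id (snd p)) \<in> borel \<Otimes>\<^sub>M lebesgue \<rightarrow>\<^sub>M (borel :: 'a measure)"
      by measurable
    then show ?thesis by (simp add: case_prod_beta)
  qed
  have k_diff [measurable]: "(\<lambda>(x, y). k (x - y)) \<in> borel_measurable (borel \<Otimes>\<^sub>M lebesgue)"
    using measurable_compose[OF diff, of k borel] by (simp add: case_prod_beta')
  have [measurable]: "(\<lambda>y. k (x - y)) \<in> borel_measurable lebesgue" for x
    by (intro measurable_completion) simp
  have meas: "convol k f \<in> borel_measurable borel"
    unfolding convol_def[abs_def]
    by (rule L.borel_measurable_lebesgue_integral) simp
  define K where "K = (\<integral>\<^sup>+y. norm (k y) \<partial>lborel)"
  have K: "K < \<infinity>"
    using k by (simp add: K_def integrable_iff_bounded)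
  have K_left: "(\<integral>\<^sup>+x. norm (k (x - y)) \<partial>lborel) = K" for y
    using nn_integral_distr[of "(+) (- y)" lborel borel "\<lambda>x. ennreal (norm (k x))"]
      lborel_distr_plus[of "- y"]
    by (simp add: K_def)
  have K_right: "(\<integral>\<^sup>+y. norm (k (x - y)) \<partial>lebesgue) = K" for x
  proof -
    have "K = (\<integral>\<^sup>+y. norm (k y) \<partial>distr lebesgue lebesgue ((-) x))"
      by (simp add: K_def distr_lebesgue_minus nn_integral_completion)
    also have "\<dots> = (\<integral>\<^sup>+y. norm (k (x - y)) \<partial>lebesgue)"
      by (rule nn_integral_distr) (auto intro: distr_lebesgue_minus measurable_completion)
    finally show ?thesis by simp
  qed
  have pointwise: "ennreal ((norm (convol k f x))\<^sup>2) \<le>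
      K * (\<integral>\<^sup>+y. ennreal (norm (k (x - y)) * (norm (f y))\<^sup>2) \<partial>lebesgue)" for x
  proof -
    have "ennreal (norm (convol k f x)) \<le> (\<integral>\<^sup>+y. norm (k (x - y) * f y) \<partial>lebesgue)"
    \<comment> \<open>A divergent convolution integral has the value 0 by convention, and the bound
      is then trivial.\<close>
    proof (cases "integrable lebesgue (\<lambda>y. k (x - y) * f y)")
      case True
      then show ?thesis
        unfolding convol_def by (rule integral_norm_bound_ennreal)
    qed (simp add: convol_def not_integrable_integral_eq)
    also have "\<dots> = (\<integral>\<^sup>+y. ennreal (sqrt (norm (k (x - y)))) *
        ennreal (sqrt (norm (k (x - y))) * norm (f y)) \<partial>lebesgue)"
      by (simp add: norm_mult ennreal_mult[symmetric] mult.assoc[symmetric])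
    finally have "(ennreal (norm (convol k f x)))\<^sup>2 \<le> (\<dots>)\<^sup>2"
      by (rule power_mono) simp
    also have "\<dots> \<le> (\<integral>\<^sup>+y. (ennreal (sqrt (norm (k (x - y)))))\<^sup>2 \<partial>lebesgue) *
        (\<integral>\<^sup>+y. (ennreal (sqrt (norm (k (x - y))) * norm (f y)))\<^sup>2 \<partial>lebesgue)"
      by (rule Cauchy_Schwarz_nn_integral) simp_all
    also have "\<dots> = K * (\<integral>\<^sup>+y. ennreal (norm (k (x - y)) * (norm (f y))\<^sup>2) \<partial>lebesgue)"
      by (simp add: ennreal_power power_mult_distrib K_right)
    finally show ?thesis
      by (simp add: ennreal_power)
  qed
  have "(\<integral>\<^sup>+x. ennreal ((norm (convol k f x))\<^sup>2) \<partial>lborel) \<le>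
      (\<integral>\<^sup>+x. K * (\<integral>\<^sup>+y. ennreal (norm (k (x - y)) * (norm (f y))\<^sup>2) \<partial>lebesgue) \<partial>lborel)"
    by (intro nn_integral_mono pointwise)
  also have "\<dots> = K * (\<integral>\<^sup>+x. (\<integral>\<^sup>+y. ennreal (norm (k (x - y)) * (norm (f y))\<^sup>2) \<partial>lebesgue) \<partial>lborel)"
    by (intro nn_integral_cmult) simp
  also have "(\<integral>\<^sup>+x. (\<integral>\<^sup>+y. ennreal (norm (k (x - y)) * (norm (f y))\<^sup>2) \<partial>lebesgue) \<partial>lborel) =
      (\<integral>\<^sup>+y. (\<integral>\<^sup>+x. ennreal (norm (k (x - y)) * (norm (f y))\<^sup>2) \<partial>lborel) \<partial>lebesgue)"
    by (rule P.Fubini'[symmetric]) simp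
  also have "\<dots> = (\<integral>\<^sup>+y. K * ennreal ((norm (f y))\<^sup>2) \<partial>lebesgue)"
    by (simp add: ennreal_mult nn_integral_multc K_left)
  also have "\<dots> = K * (\<integral>\<^sup>+y. ennreal ((norm (f y))\<^sup>2) \<partial>lebesgue)"
    by (intro nn_integral_cmult) simp
  also have "K * \<dots> < \<infinity>"
    using f K by (auto simp: L2_space_def integrable_iff_bounded ennreal_mult_less_top)
  finally have "integrable lborel (\<lambda>x. (norm (convol k f x))\<^sup>2)"
    using meas by (intro integrableI_bounded) simp_all
  then show ?thesis
    using meas by (auto simp: L2_space_def integrable_completion intro: measurable_completion)
qed

text \<open>The Gaussian is a product of one-dimensional factors over the coordinates, so its
  integral is a power of a finite integral.\<close>

lemma integrable_gaussian:
  assumes "a > 0"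
  shows "integrable lborel (\<lambda>x::'a::euclidean_space. exp (- a * (norm x)\<^sup>2))"
proof -
  have fin: "(\<integral>\<^sup>+x. ennreal (exp (- a * x\<^sup>2)) \<partial>lborel) < \<infinity>"
  proof -
    \<comment> \<open>With this standard deviation the exponent of the normal density is
      \<open>- a * x\<^sup>2\<close>, so finiteness follows from integrability of that
      density.\<close>
    define \<sigma> where "\<sigma> = sqrt (1 / (2 * a))"
    have \<sigma>: "\<sigma> > 0" "\<sigma>\<^sup>2 = 1 / (2 * a)"
      using assms by (simp_all add: \<sigma>_def)
    have "integrable lborel (\<lambda>x. sqrt (2 * pi * \<sigma>\<^sup>2) * normal_density 0 \<sigma> x)"
      using \<sigma> by (intro integrable_mult_right integrable_normal_density)
    also have "(\<lambda>x. sqrt (2 * pi * \<sigma>\<^sup>2) * normal_density 0 \<sigma> x) = (\<lambda>x. exp (- a * x\<^sup>2))"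
      using assms \<sigma> by (auto simp: normal_density_def fun_eq_iff)
    finally show ?thesis
      by (simp add: integrable_iff_bounded)
  qed
  have "ennreal (exp (- a * (norm x)\<^sup>2)) = (\<Prod>b\<in>Basis. ennreal (exp (- a * (x \<bullet> b)\<^sup>2)))" for x :: 'a
    by (subst power2_norm_eq_inner, subst euclidean_inner)
       (simp add: power2_eq_square prod_ennreal exp_sum[symmetric] sum_distrib_left sum_negf)
  then have "(\<integral>\<^sup>+x. ennreal (exp (- a * (norm (x::'a))\<^sup>2)) \<partial>lborel) =
      (\<Prod>b\<in>(Basis::'a set). \<integral>\<^sup>+x. ennreal (exp (- a * x\<^sup>2)) \<partial>lborel)"
    by (subst nn_integral_lborel_prod[symmetric]) simp_all
  also have "\<dots> < \<infinity>"
    using fin by (simp add: power_less_top_ennreal)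
  finally show ?thesis
    by (intro integrableI_bounded) simp_all
qed

lemma integrable_heat_kernel:
  assumes "T > 0"
  shows "integrable lborel (heat_kernel T)"
proof -
  have "integrable lborel
      (\<lambda>x::real^2. complex_of_real (1 / (4 * pi * T) * exp (- (1 / (4 * T)) * (norm x)\<^sup>2)))"
    using assms by (intro integrable_of_real integrable_mult_right integrable_gaussian) simp
  then show ?thesis
    by (simp add: heat_kernel_def[abs_def])
qed

section \<open>Evenness in the first coordinate\<close>

abbreviation refl1 :: "real^2 \<Rightarrow> real^2" where
  "refl1 x \<equiv> vector [- (x$1), x$2]"

lemma distr_lebesgue_refl1:
  "distr lebesgue lebesgue refl1 = lebesgue" "refl1 \<in> lebesgue \<rightarrow>\<^sub>M lebesgue"
proof -
  \<comment> \<open>\<open>axis 1 1\<close> is the first standard basis vector, so these signs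
    present \<open>refl1\<close> as a diagonal map with entries -1 and 1.\<close>
  define c :: "real^2 \<Rightarrow> real" where "c j = (if j = axis 1 1 then - 1 else 1)" for j
  have "refl1 = (\<lambda>x. 0 + (\<Sum>j\<in>Basis. (c j * (x \<bullet> j)) *\<^sub>R j))"
  proof
    fix x :: "real^2"
    have Basis: "(Basis :: (real^2) set) = (\<lambda>i. axis i 1) ` UNIV"
      by (auto simp: Basis_vec_def)
    have "inj (\<lambda>i::2. axis i (1::real))"
      by (simp add: inj_on_def axis_eq_axis)
    then have "(\<Sum>j\<in>Basis. (c j * (x \<bullet> j)) *\<^sub>R j) = (\<Sum>i\<in>UNIV. (c (axis i 1) * x $ i) *\<^sub>R axis i 1)"
      unfolding Basis by (subst sum.reindex) (simp_all add: inner_axis)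
    then show "refl1 x = 0 + (\<Sum>j\<in>Basis. (c j * (x \<bullet> j)) *\<^sub>R j)"
      by (simp add: vec_eq_iff forall_2 sum_2 c_def axis_eq_axis) (simp add: axis_def)
  qed
  moreover have "\<bar>c j\<bar> = 1" for j
    by (simp add: c_def)
  ultimately show "distr lebesgue lebesgue refl1 = lebesgue" "refl1 \<in> lebesgue \<rightarrow>\<^sub>M lebesgue"
    using distr_lebesgue_reflection[of c 0] by simp_all
qed

lemma Hhat0_diff:
  assumes "f \<in> Hhat0" "g \<in> Hhat0"
  shows "(\<lambda>x. f x - g x) \<in> Hhat0"
proof -
  have "AE x in lebesgue. f (vector [- (x$1), x$2]) = f x"
    "AE x in lebesgue. g (vector [- (x$1), x$2]) = g x"
    using assms by (simp_all add: Hhat0_def)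
  then have "AE x in lebesgue. f (vector [- (x$1), x$2]) - g (vector [- (x$1), x$2]) = f x - g x"
    by eventually_elim simp
  then show ?thesis
    using assms by (simp add: Hhat0_def L2_space_diff)
qed

lemma Hhat0_cmult:
  assumes "f \<in> Hhat0"
  shows "(\<lambda>x. c * f x) \<in> Hhat0"
proof -
  have "AE x in lebesgue. f (vector [- (x$1), x$2]) = f x"
    using assms by (simp add: Hhat0_def)
  then have "AE x in lebesgue. c * f (vector [- (x$1), x$2]) = c * f x"
    by eventually_elim simp
  then show ?thesis
    using assms by (simp add: Hhat0_def L2_space_cmult)
qed

text \<open>The reflection preserves both the heat kernel and Lebesgue measure; substituting it in
  the convolution gives evenness at every point. Square integrability comes from the convolution
  estimate with an integrable kernel.\<close>

lemma convol_heat_kernel_in_Hhat0: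
  assumes T: "T > 0" and g: "g \<in> Hhat0"
  shows "convol (heat_kernel T) g \<in> Hhat0"
proof -
  have [measurable]: "g \<in> borel_measurable lebesgue"
    using g by (simp add: Hhat0_def L2_space_def)
  have g_even: "AE x in lebesgue. g (refl1 x) = g x"
    using g by (simp add: Hhat0_def)
  have [measurable]: "heat_kernel T \<in> borel_measurable borel"
    using borel_measurable_integrable[OF integrable_heat_kernel[OF T]] by simp
  have [measurable]: "(\<lambda>y. heat_kernel T (x - y)) \<in> borel_measurable lebesgue" for x
    by (intro measurable_completion) simp
  note [measurable] = distr_lebesgue_refl1(2)
  have kernel_even: "heat_kernel T (refl1 x - refl1 y) = heat_kernel T (x - y)" for x y
    by (simp add: heat_kernel_def power2_norm_eq_inner inner_vec_def sum_2 algebra_simps)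
  have "convol (heat_kernel T) g (refl1 x) = convol (heat_kernel T) g x" for x
  proof -
    have "convol (heat_kernel T) g (refl1 x) =
        (LINT y|distr lebesgue lebesgue refl1. heat_kernel T (refl1 x - y) * g y)"
      by (simp add: convol_def distr_lebesgue_refl1)
    also have "\<dots> = (LINT y|lebesgue. heat_kernel T (refl1 x - refl1 y) * g (refl1 y))"
      by (rule integral_distr) simp_all
    also have "\<dots> = (LINT y|lebesgue. heat_kernel T (x - y) * g (refl1 y))"
      by (simp add: kernel_even)
    \<comment> \<open>Evenness of \<open>g\<close> holds only almost everywhere, which suffices
      under the integral.\<close>
    also have "\<dots> = (LINT y|lebesgue. heat_kernel T (x - y) * g y)"
      using g_even by (intro integral_cong_AE) (auto elim: eventually_mono)
    finally show ?thesis
      by (simp add: convol_def)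
  qed
  moreover have "convol (heat_kernel T) g \<in> L2_space lebesgue"
    using g by (intro convol_in_L2_space integrable_heat_kernel T) (simp add: Hhat0_def)
  ultimately show ?thesis
    by (simp add: Hhat0_def)
qed

section \<open>Scaling and monotonicity of the reachable sets\<close>

lemma W_free_zero: "W_free (\<lambda>x. 0) T x = 0"
  by (simp add: W_free_def convol_def)

lemma Linf_norm_cmult:
  assumes "c > 0"
  shows "Linf_norm M (\<lambda>x. complex_of_real c * u x) = ereal c * Linf_norm M u"
  using esssup_cmult[OF assms, of M "\<lambda>x. ereal (norm (u x))"] assms
  by (simp add: Linf_norm_def norm_mult)

text \<open>This holds even where the integral diverges: for \<open>c \<noteq> 0\<close> both
  integrals then have the default value 0, and for \<open>c = 0\<close> both sides vanish.\<close>

lemma W_ctrl_cmult: "W_ctrl (\<lambda>t. c * u t) T x = c * W_ctrl u T x"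
  unfolding W_ctrl_def by (simp only: mult.left_commute[of _ c] integral_mult_right_zero)

text \<open>The control is scaled along with the state. Applied with \<open>L\<close> and with
  \<open>1 / L\<close>, this one implication yields both directions of the scaling
  equivalence.\<close>

lemma Reach_bdd_zero_cmult:
  assumes "f \<in> Reach_bdd T L (\<lambda>x. 0)" "c > 0"
  shows "(\<lambda>x. complex_of_real c * f x) \<in> Reach_bdd T (c * L) (\<lambda>x. 0)"
proof -
  let ?M = "lebesgue_on {0<..<T}"
  obtain u where u: "u \<in> Linf_space ?M" "Linf_norm ?M u \<le> ereal L"
      "AE x in lebesgue. f x = W_ctrl u T x" and f: "f \<in> Hhat0"
    using assms by (auto simp: Reach_bdd_def W_free_zero)
  have norm_le: "Linf_norm ?M (\<lambda>t. complex_of_real c * u t) \<le> ereal (c * L)"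
    using u(2) assms(2) by (simp add: Linf_norm_cmult ereal_mult_left_mono flip: times_ereal.simps)
  then have "(\<lambda>t. complex_of_real c * u t) \<in> Linf_space ?M"
    using u(1) by (auto simp: Linf_space_def dest: le_less_trans)
  moreover have "AE x in lebesgue. complex_of_real c * f x = W_ctrl (\<lambda>t. complex_of_real c * u t) T x"
    using u(3) by (auto simp: W_ctrl_cmult elim: eventually_mono)
  ultimately show ?thesis
    using norm_le f by (auto simp: Reach_bdd_def W_free_zero Hhat0_cmult)
qed

lemma Reach_bdd_mono:
  assumes "L \<le> L'"
  shows "Reach_bdd T L W0 \<subseteq> Reach_bdd T L' W0"
proof -
  have "y \<le> ereal L'" if "y \<le> ereal L" for y
    using that assms by (meson ereal_less_eq(3) order_trans)
  then show ?thesis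
    unfolding Reach_bdd_def by blast
qed

lemma Reach_eq_Union_Reach_bdd: "Reach T W0 = (\<Union>L\<in>{0<..}. Reach_bdd T L W0)"
proof -
  have "\<exists>L>0. Linf_norm M u \<le> ereal L" if "u \<in> Linf_space M" for M :: "real measure" and u
  proof -
    obtain r :: real where "Linf_norm M u \<le> ereal r"
      using \<open>u \<in> Linf_space M\<close> by (cases "Linf_norm M u") (auto simp: Linf_space_def)
    then show ?thesis
      \<comment> \<open>The finite bound \<open>r\<close> need not be positive, whereas the index of
        the union must be.\<close>
      by (intro exI[of _ "max 1 r"]) (auto intro: order_trans)
  qed
  then show ?thesis
    by (fastforce simp: Reach_def Reach_bdd_def)
qed

section \<open>Radial profiles of controlled states\<close>

text \<open>For \<open>y = s / (4 * \<xi>)\<close>, the chain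
  \<open>y powr a \<le> (1 + y) powr a \<le> 1 + y \<le> exp y\<close> bounds
  \<open>exp (- y)\<close> by \<open>y powr (- a)\<close>. The exponent \<open>a\<close> trades
  decay in \<open>s\<close> against the singularity at \<open>\<xi> = 0\<close>.\<close>

lemma heat_profile_le_powr:
  fixes s \<xi> a :: real
  assumes "s > 0" "\<xi> > 0" "0 \<le> a" "a \<le> 1"
  shows "1 / (2 * \<xi>) * exp (- s / (4 * \<xi>)) \<le> 2 * s powr (- a) * \<xi> powr (a - 1)"
proof -
  define y where "y = s / (4 * \<xi>)"
  have y: "y > 0" using assms by (simp add: y_def)
  have "y powr a \<le> (1 + y) powr a"
    using y assms by (intro powr_mono2) auto
  also have "\<dots> \<le> (1 + y) powr 1"
    using y assms by (intro powr_mono) auto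
  also have "\<dots> \<le> exp y"
    using y exp_ge_add_one_self[of y] by simp
  finally have "exp (- y) \<le> y powr (- a)"
    using y by (simp add: exp_minus powr_minus le_imp_inverse_le)
  also have "\<dots> = s powr (- a) * 4 powr a * \<xi> powr a"
    using assms by (simp add: y_def powr_divide powr_mult powr_minus field_simps)
  \<comment> \<open>Replacing \<open>4 powr a\<close> by 4 makes the constant independent of
    \<open>a\<close>; the prefactor 1/2 turns it into 2.\<close>
  also have "\<dots> \<le> s powr (- a) * 4 * \<xi> powr a"
    using assms powr_mono[of a 1 4] by (intro mult_right_mono mult_left_mono) auto
  finally have "1 / (2 * \<xi>) * exp (- y) \<le> 1 / (2 * \<xi>) * (s powr (- a) * 4 * \<xi> powr a)"
    using assms by (intro mult_left_mono) auto
  also have "\<dots> = 2 * s powr (- a) * \<xi> powr (a - 1)"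
    using assms by (simp add: powr_diff)
  finally show ?thesis
    by (simp add: y_def)
qed

text \<open>For a nonnegative integrand, gauge integrability is absolute integrability. This carries
  the gauge integrals of powers over to the Lebesgue integral.\<close>

lemma integrable_lebesgue_on_nonneg:
  fixes f :: "real \<Rightarrow> real"
  assumes "f integrable_on S" "\<And>x. x \<in> S \<Longrightarrow> 0 \<le> f x" "S \<in> sets lebesgue"
  shows "integrable (lebesgue_on S) f"
proof -
  have "f absolutely_integrable_on S"
    using assms by (subst absolutely_integrable_on_iff_nonneg) auto
  then show ?thesis
    using assms by (simp add: integrable_restrict_space set_integrable_def)
qed

text \<open>The exponents \<open>a = 1/4\<close> near the origin and \<open>a = 1\<close> at infinity in the estimate
  \<open>heat_profile_le_powr\<close> make the profile square integrable.\<close>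

lemma W_ctrl_radial_profile:
  assumes T: "T > 0" and u: "u \<in> Linf_space (lebesgue_on {0<..<T})"
  obtains h where "h \<in> L2_space (lebesgue_on {0<..})" "\<And>x. W_ctrl u T x = h ((norm x)\<^sup>2)"
proof -
  let ?M = "lebesgue_on {0<..<T}"
  \<comment> \<open>Up to the factor \<open>-1/pi\<close>, this is the controlled state as a
    function of the squared radius \<open>s\<close>.\<close>
  define J where "J s = (LINT \<xi>|?M.
      complex_of_real (1 / (2 * \<xi>) * exp (- s / (4 * \<xi>))) * u (T - \<xi>))" for s
  interpret M: sigma_finite_measure ?M
    by (rule sigma_finite_measure_restrict_space[OF sigma_finite_lebesgue]) simp
  have [measurable]: "u \<in> borel_measurable ?M"
    using u by (simp add: Linf_space_def)
  have rev [measurable]: "(\<lambda>\<xi>. T - \<xi>) \<in> ?M \<rightarrow>\<^sub>M ?M"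
    by (rule measurable_restrict_space3) (auto intro: distr_lebesgue_minus(2))
  have [measurable]: "id \<in> ?M \<rightarrow>\<^sub>M (borel :: real measure)"
    by (auto simp: id_def intro!: measurable_restrict_space1 measurable_completion)
  have J_meas: "J \<in> borel_measurable borel"
  proof -
    \<comment> \<open>Writing \<open>id \<xi>\<close> again routes the variable from the completed
      sigma-algebra to the Borel one.\<close>
    have "(\<lambda>(s, \<xi>). complex_of_real (1 / (2 * id \<xi>) * exp (- s / (4 * id \<xi>))) * u (T - \<xi>))
        \<in> borel_measurable (borel \<Otimes>\<^sub>M ?M)"
      by measurable
    then show ?thesis
      unfolding J_def[abs_def] by (intro M.borel_measurable_lebesgue_integral) simp
  qed
  obtain C where C: "C > 0" "AE \<xi> in ?M. norm (u (T - \<xi>)) \<le> C"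
  proof -
    obtain r :: real where r: "Linf_norm ?M u \<le> ereal r"
      using u by (cases "Linf_norm ?M u") (auto simp: Linf_space_def)
    have "AE t in ?M. ereal (norm (u t)) \<le> Linf_norm ?M u"
      unfolding Linf_norm_def by (rule esssup_AE)
    then have "AE t in ?M. norm (u t) \<le> max 1 r"
      using r by (auto elim!: eventually_mono dest: order_trans)
    \<comment> \<open>Reflection invariance concerns the whole line, so the restriction to
      \<open>{0<..<T}\<close> becomes an implication before the substitution \<open>T - t\<close>
      and a restriction again after it.\<close>
    then have "AE t in lebesgue. t \<in> {0<..<T} \<longrightarrow> norm (u t) \<le> max 1 r"
      by (simp add: AE_restrict_space_iff)
    then have "AE t in distr lebesgue lebesgue ((-) T). t \<in> {0<..<T} \<longrightarrow> norm (u t) \<le> max 1 r"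
      by (simp only: distr_lebesgue_minus)
    then have "AE t in lebesgue. T - t \<in> {0<..<T} \<longrightarrow> norm (u (T - t)) \<le> max 1 r"
      by (rule AE_distrD[OF distr_lebesgue_minus(2)])
    then have "AE t in ?M. norm (u (T - t)) \<le> max 1 r"
      by (auto simp: AE_restrict_space_iff elim!: eventually_mono)
    then show thesis
      using that[of "max 1 r"] by simp
  qed
  \<comment> \<open>Here \<open>a > 0\<close> makes \<open>\<xi> powr (a - 1)\<close> integrable at
    0, and \<open>a \<le> 1\<close> is the range of the pointwise estimate.\<close>
  have bound: "\<exists>B\<ge>0. \<forall>s>0. norm (J s) \<le> B * s powr (- a)" if a: "0 < a" "a \<le> 1" for a
  proof -
    have int: "integrable ?M (\<lambda>\<xi>. \<xi> powr (a - 1))"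
    proof (rule integrable_lebesgue_on_nonneg)
      have "(\<lambda>\<xi>. \<xi> powr (a - 1)) integrable_on {0..T}"
        using a T by (intro integrable_on_powr_from_0) auto
      then show "(\<lambda>\<xi>. \<xi> powr (a - 1)) integrable_on {0<..<T}"
        by (simp add: integrable_on_Icc_iff_Ioo)
    qed auto
    define I where "I = (LINT \<xi>|?M. \<xi> powr (a - 1))"
    have "norm (J s) \<le> (2 * C * I) * s powr (- a)" if s: "s > 0" for s
    proof -
      have "norm (J s) \<le> (LINT \<xi>|?M.
          norm (complex_of_real (1 / (2 * \<xi>) * exp (- s / (4 * \<xi>))) * u (T - \<xi>)))"
        unfolding J_def by (rule integral_norm_bound)
      also have "\<dots> \<le> (LINT \<xi>|?M. (2 * C * s powr (- a)) * \<xi> powr (a - 1))"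
      \<comment> \<open>It suffices that the majorant is integrable and nonnegative: a divergent
        integral on the left would be 0 by convention.\<close>
      proof (rule integral_mono_AE')
        have "AE \<xi> in ?M. \<xi> \<in> space ?M"
          by (rule AE_space)
        then show "AE \<xi> in ?M. norm (complex_of_real (1 / (2 * \<xi>) * exp (- s / (4 * \<xi>))) * u (T - \<xi>))
            \<le> (2 * C * s powr (- a)) * \<xi> powr (a - 1)"
          using C(2)
        proof eventually_elim
          case (elim \<xi>)
          then have "\<xi> > 0" by simp
          have "norm (complex_of_real (1 / (2 * \<xi>) * exp (- s / (4 * \<xi>))) * u (T - \<xi>)) =
              (1 / (2 * \<xi>) * exp (- s / (4 * \<xi>))) * norm (u (T - \<xi>))"
            using \<open>\<xi> > 0\<close> by (simp only: norm_mult norm_of_real) simp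
          also have "\<dots> \<le> (2 * s powr (- a) * \<xi> powr (a - 1)) * C"
            using \<open>\<xi> > 0\<close> s a elim by (intro mult_mono heat_profile_le_powr) auto
          finally show ?case by (simp add: mult_ac)
        qed
      qed (use int C in auto)
      also have "\<dots> = (2 * C * I) * s powr (- a)"
        by (simp add: I_def)
      finally show ?thesis .
    qed
    moreover have "2 * C * I \<ge> 0"
      using C by (simp add: I_def)
    ultimately show ?thesis by blast
  qed
  obtain B1 where B1: "B1 \<ge> 0" "\<And>s. s > 0 \<Longrightarrow> norm (J s) \<le> B1 * s powr (- (1/4))"
    using bound[of "1/4"] by auto
  obtain B2 where B2: "B2 \<ge> 0" "\<And>s. s > 0 \<Longrightarrow> norm (J s) \<le> B2 * s powr (- 1)"
    using bound[of 1] by auto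
  have J_meas': "J \<in> borel_measurable (lebesgue_on {0<..})"
    using J_meas by (intro measurable_restrict_space1 measurable_completion) simp
  have "integrable (lebesgue_on {0<..}) (\<lambda>s. (norm (J s))\<^sup>2)"
  proof -
    define b where "b s = (if s \<in> {0..1} then B1\<^sup>2 * s powr (- (1/2)) else 0) +
        (if s \<in> {1..} then B2\<^sup>2 * s powr (- 2) else 0)" for s :: real
    have "(\<lambda>s. if s \<in> {0..1} then B1\<^sup>2 * s powr (- (1/2)) else 0) integrable_on UNIV"
      using integrable_cmul[OF integrable_on_powr_from_0[of "- (1/2)" 1], of "B1\<^sup>2"]
      by (subst integrable_restrict_UNIV) simp
    moreover have "(\<lambda>s. if s \<in> {1..} then B2\<^sup>2 * s powr (- 2) else 0) integrable_on UNIV"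
      using integrable_cmul[OF has_integral_integrable[OF has_integral_powr_to_inf[of "-2" 1]], of "B2\<^sup>2"]
      by (subst integrable_restrict_UNIV) simp
    ultimately have "b integrable_on UNIV"
      unfolding b_def[abs_def] by (rule integrable_add)
    then have "integrable (lebesgue_on UNIV) b"
      by (rule integrable_lebesgue_on_nonneg) (auto simp: b_def)
    then have "integrable (lebesgue_on {0<..}) b"
      using integrable_mult_indicator[of "{0<..}" lebesgue b]
      by (simp add: lebesgue_on_UNIV_eq integrable_restrict_space)
    moreover have "norm ((norm (J s))\<^sup>2) \<le> norm (b s)" if "s > 0" for s
    proof (cases "s \<le> 1")
      case True
      have "(norm (J s))\<^sup>2 \<le> (B1 * s powr (- (1/4)))\<^sup>2"
        using B1(2)[OF that] by (intro power_mono) auto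
      also have "\<dots> = B1\<^sup>2 * s powr (- (1/2))"
        using that by (simp add: power_mult_distrib power2_eq_square[of "s powr _"] flip: powr_add)
      also have "\<dots> \<le> b s"
        using that True by (simp add: b_def)
      finally show ?thesis by simp
    next
      case False
      have "(norm (J s))\<^sup>2 \<le> (B2 * s powr (- 1))\<^sup>2"
        using B2(2)[OF that] by (intro power_mono) auto
      also have "\<dots> = B2\<^sup>2 * s powr (- 2)"
        by (simp only: power_mult_distrib power2_eq_square[of "s powr _"] flip: powr_add) simp
      also have "\<dots> = b s"
        using that False by (simp add: b_def)
      finally show ?thesis by simp
    qed
    ultimately show ?thesis
      using J_meas' by (rule_tac Bochner_Integration.integrable_bound) (auto simp: AE_restrict_space_iff)
  qed
  then have "J \<in> L2_space (lebesgue_on {0<..})"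
    using J_meas' by (simp add: L2_space_def)
  then have "(\<lambda>s. - complex_of_real (1 / pi) * J s) \<in> L2_space (lebesgue_on {0<..})"
    by (rule L2_space_cmult)
  moreover have "W_ctrl u T x = - complex_of_real (1 / pi) * J ((norm x)\<^sup>2)" for x
    by (simp only: W_ctrl_def J_def)
  ultimately show thesis
    by (rule that)
qed

lemma Reach_zero_subset_H_radial:
  assumes "T > 0"
  shows "Reach T (\<lambda>x. 0) \<subseteq> H_radial"
proof
  fix f assume "f \<in> Reach T (\<lambda>x. 0)"
  then obtain u where u: "u \<in> Linf_space (lebesgue_on {0<..<T})"
      "AE x in lebesgue. f x = W_ctrl u T x" and f: "f \<in> Hhat0"
    by (auto simp: Reach_def W_free_zero)
  obtain h where "h \<in> L2_space (lebesgue_on {0<..})" "\<And>x. W_ctrl u T x = h ((norm x)\<^sup>2)"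
    using W_ctrl_radial_profile[OF assms u(1)] by blast
  then show "f \<in> H_radial"
    using u(2) f by (auto simp: H_radial_def Hhat0_def)
qed

section \<open>Subtracting the free evolution, and assembly of the five claims\<close>

lemma diff_convol_heat_kernel_in_Hhat0_iff:
  assumes "T > 0" "g \<in> Hhat0"
  shows "(\<lambda>x. f x - convol (heat_kernel T) g x) \<in> Hhat0 \<longleftrightarrow> f \<in> Hhat0"
proof
  assume "(\<lambda>x. f x - convol (heat_kernel T) g x) \<in> Hhat0"
  \<comment> \<open>Subtracting -1 times the convolution adds it back.\<close>
  from Hhat0_diff[OF this Hhat0_cmult[OF convol_heat_kernel_in_Hhat0[OF assms], of "- 1"]]
  show "f \<in> Hhat0" by simp
qed (rule Hhat0_diff[OF _ convol_heat_kernel_in_Hhat0[OF assms]])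

text \<open>The same control witnesses both memberships, because the free part only moves across a
  pointwise equation.\<close>

lemma Reach_bdd_iff_diff:
  assumes "T > 0" "g \<in> Hhat0"
  shows "f \<in> Reach_bdd T L g \<longleftrightarrow>
    (\<lambda>x. f x - convol (heat_kernel T) g x) \<in> Reach_bdd T L (\<lambda>x. 0)"
proof -
  have "f x = W_free g T x + w \<longleftrightarrow> f x - convol (heat_kernel T) g x = w" for x w
    by (auto simp: W_free_def)
  then show ?thesis
    by (simp only: Reach_bdd_def mem_Collect_eq W_free_zero add_0_left
        diff_convol_heat_kernel_in_Hhat0_iff[OF assms])
qed

theorem theorem3p5:
  fixes T :: real and g :: "real^2 \<Rightarrow> complex"
  assumes "T > 0" and "g \<in> Hhat0"
  shows "(Reach T (\<lambda>x. 0) = (\<Union>L\<in>{0<..}. Reach_bdd T L (\<lambda>x. 0))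
          \<and> (\<Union>L\<in>{0<..}. Reach_bdd T L (\<lambda>x. 0)) \<subseteq> H_radial)
    \<and> (\<forall>L L'. 0 < L \<and> L < L' \<longrightarrow> Reach_bdd T L (\<lambda>x. 0) \<subseteq> Reach_bdd T L' (\<lambda>x. 0))
    \<and> (\<forall>L>0. \<forall>f :: real^2 \<Rightarrow> complex.
          f \<in> Reach_bdd T 1 (\<lambda>x. 0) \<longleftrightarrow> (\<lambda>x. complex_of_real L * f x) \<in> Reach_bdd T L (\<lambda>x. 0))
    \<and> (\<forall>L>0. \<forall>f :: real^2 \<Rightarrow> complex.
          f \<in> Reach_bdd T L g \<longleftrightarrow>
          (\<lambda>x. f x - convol (heat_kernel T) g x) \<in> Reach_bdd T L (\<lambda>x. 0))
    \<and> (\<forall>f :: real^2 \<Rightarrow> complex.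
          f \<in> Reach T g \<longleftrightarrow>
          (\<lambda>x. f x - convol (heat_kernel T) g x) \<in> Reach T (\<lambda>x. 0))"
proof (intro conjI allI impI)
  show union: "Reach T (\<lambda>x. 0) = (\<Union>L\<in>{0<..}. Reach_bdd T L (\<lambda>x. 0))"
    by (rule Reach_eq_Union_Reach_bdd)
  show "(\<Union>L\<in>{0<..}. Reach_bdd T L (\<lambda>x. 0)) \<subseteq> H_radial"
    using Reach_zero_subset_H_radial[OF assms(1)] by (simp only: union)
  show "Reach_bdd T L (\<lambda>x. 0) \<subseteq> Reach_bdd T L' (\<lambda>x. 0)" if "0 < L \<and> L < L'" for L L'
    using that by (intro Reach_bdd_mono) simp
  show "f \<in> Reach_bdd T 1 (\<lambda>x. 0) \<longleftrightarrow> (\<lambda>x. complex_of_real L * f x) \<in> Reach_bdd T L (\<lambda>x. 0)"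
    if "L > 0" for L f
  proof
    show "(\<lambda>x. complex_of_real L * f x) \<in> Reach_bdd T L (\<lambda>x. 0)" if "f \<in> Reach_bdd T 1 (\<lambda>x. 0)"
      using Reach_bdd_zero_cmult[OF that \<open>L > 0\<close>] by simp
    have cancel: "complex_of_real (1 / L) * (complex_of_real L * z) = z" for z
      using \<open>L > 0\<close> by simp
    show "f \<in> Reach_bdd T 1 (\<lambda>x. 0)" if "(\<lambda>x. complex_of_real L * f x) \<in> Reach_bdd T L (\<lambda>x. 0)"
      using Reach_bdd_zero_cmult[OF that, of "1 / L"] \<open>L > 0\<close> unfolding cancel by simp
  qed
  show "f \<in> Reach_bdd T L g \<longleftrightarrow>
      (\<lambda>x. f x - convol (heat_kernel T) g x) \<in> Reach_bdd T L (\<lambda>x. 0)" for L f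
    by (rule Reach_bdd_iff_diff[OF assms])
  show "f \<in> Reach T g \<longleftrightarrow> (\<lambda>x. f x - convol (heat_kernel T) g x) \<in> Reach T (\<lambda>x. 0)" for f
    \<comment> \<open>Both sides are unions over the bounds, so the equivalence for each fixed bound
      gives the unrestricted one.\<close>
    unfolding Reach_eq_Union_Reach_bdd UN_iff Reach_bdd_iff_diff[OF assms, symmetric] ..
qed

end
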